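(* Let $d\ge 1$ be an integer and let $G$ be a connected bipartite graph with $|V(G)|\ge 2d+2$ and $\alpha(G)\ge d+1$. Then there is a set $S\subseteq E(G)$ with $|S|\le 2d+1$ such that $\alpha(G/S)\le \alpha(G)-d$.
   Context: All graphs are finite and simple. $\alpha$ denotes the independence number. For $S\subseteq E(G)$, let $G|_S$ be the graph with vertex set $V(G)$ and edge set $S$; the contraction $G/S$ is the graph whose vertices correspond to the connected components of $G|_S$, two vertices being adjacent iff the corresponding components $A,B$ satisfy $\mathrm{dist}_G(V(A),V(B))=1$. *)

theory Defs
  imports "HOL-Library.Ramsey" "HOL-Library.Extended_Nat"
begin

record 'a ugraph =
  verts :: "'a set"
  edges :: "'a set set"

definition simple_graph :: "'a ugraph \<Rightarrow> bool" where
  "simple_graph G \<longleftrightarrow> finite (verts G) \<and> edges G \<subseteq> nsets (verts G) 2"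

definition adj :: "'a ugraph \<Rightarrow> 'a rel" where
  "adj G = {(u, v). {u, v} \<in> edges G}"

definition connected_graph :: "'a ugraph \<Rightarrow> bool" where
  "connected_graph G \<longleftrightarrow> verts G \<noteq> {} \<and> (\<forall>u\<in>verts G. \<forall>v\<in>verts G. (u, v) \<in> (adj G)\<^sup>*)"

definition bipartite_graph :: "'a ugraph \<Rightarrow> bool" where
  "bipartite_graph G \<longleftrightarrow>
     (\<exists>X Y. X \<union> Y = verts G \<and> X \<inter> Y = {} \<and> (\<forall>e\<in>edges G. \<exists>x\<in>X. \<exists>y\<in>Y. e = {x, y}))"

definition independence_number :: "'a ugraph \<Rightarrow> nat" where
  "independence_number G = Max (card ` {I. I \<subseteq> verts G \<and> indep I (edges G)})"

(* The length of a shortest walk between the two sets, infinite if there is none. *)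
definition set_distance :: "'a ugraph \<Rightarrow> 'a set \<Rightarrow> 'a set \<Rightarrow> enat" where
  "set_distance G A B = Inf {enat n | n u v. u \<in> A \<and> v \<in> B \<and> (u, v) \<in> adj G ^^ n}"

definition spanning_subgraph :: "'a ugraph \<Rightarrow> 'a set set \<Rightarrow> 'a ugraph" where
  "spanning_subgraph G S = \<lparr>verts = verts G, edges = S\<rparr>"

(* Each connected component is represented by its vertex set. *)
definition components :: "'a ugraph \<Rightarrow> 'a set set" where
  "components G = verts G // {(u, v). u \<in> verts G \<and> v \<in> verts G \<and> (u, v) \<in> (adj G)\<^sup>*}"

definition contract :: "'a ugraph \<Rightarrow> 'a set set \<Rightarrow> 'a set ugraph" where
  "contract G S =
     (let C = components (spanning_subgraph G S)
      in \<lparr>verts = C, edges = {{A, B} | A B. A \<in> C \<and> B \<in> C \<and> set_distance G A B = 1}\<rparr>)"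

lemma component_nonempty: "A \<in> components G \<Longrightarrow> A \<noteq> {}"
  by (auto simp: components_def quotient_def)

lemma set_distance_self:
  assumes "A \<noteq> {}"
  shows "set_distance G A A = 0"
proof -
  obtain a where "a \<in> A" using assms by blast
  then have "enat 0 \<in> {enat n | n u v. u \<in> A \<and> v \<in> A \<and> (u, v) \<in> adj G ^^ n}"
    by force
  then have "set_distance G A A \<le> enat 0"
    unfolding set_distance_def by (rule Inf_lower)
  then show ?thesis by (simp add: zero_enat_def[symmetric])
qed

lemma simple_graph_contract:
  assumes "simple_graph G"
  shows "simple_graph (contract G S)"
proof -
  let ?C = "components (spanning_subgraph G S)"
  have "?C \<subseteq> Pow (verts G)"
    by (auto simp: components_def quotient_def spanning_subgraph_def)
  then have "finite ?C"
    using assms finite_subset by (fastforce simp: simple_graph_def)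
  moreover have "A \<noteq> B" if "A \<in> ?C" "set_distance G A B = 1" for A B
    using that component_nonempty set_distance_self by (metis zero_neq_one)
  ultimately show ?thesis
    unfolding simple_graph_def contract_def Let_def by auto
qed

end

theory Submission
  imports Defs
begin

text \<open>
  Hall's marriage theorem, applied to the complement of a largest independent set \<open>A\<close>, partitions the
  vertices into \<open>\<alpha>(G)\<close> classes that are single vertices or edges. A connected set \<open>T\<close> of \<open>2d + 2\<close> vertices is
  grown so that at most one class is split by \<open>T\<close>; then at least \<open>d + 1\<close> classes lie inside \<open>T\<close>, so
  that \<open>\<alpha>(G - T) \<le> \<alpha>(G) - d - 1\<close>. Contract the edges of a spanning tree of \<open>T\<close>: an independent set of the
  quotient loses at most one vertex when the component of \<open>T\<close> is removed, and representatives of the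
  others form an independent set of \<open>G - T\<close>.
\<close>

section \<open>Hall's marriage theorem\<close>

text \<open>Induction on the number of indices. If some nonempty proper \<open>J\<close> has no more
  candidates than members, \<open>J\<close> and \<open>I - J\<close> are matched separately.
  Otherwise every such \<open>J\<close> has a candidate to spare, so one index may be matched
  arbitrarily.\<close>

lemma hall_marriage:
  fixes N :: "'i \<Rightarrow> 'b set"
  assumes "finite I" "\<And>i. i \<in> I \<Longrightarrow> finite (N i)"
    and "\<And>J. J \<subseteq> I \<Longrightarrow> card J \<le> card (\<Union>(N ` J))"
  shows "\<exists>f. inj_on f I \<and> (\<forall>i\<in>I. f i \<in> N i)"
  using assms
proof (induction "card I" arbitrary: I N rule: less_induct)
  case less
  note fin = less.prems(1) and finN = less.prems(2) and hall = less.prems(3)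
  have finU: "finite (\<Union>(N ` J))" if "J \<subseteq> I" for J
    using that fin finN by (meson finite_UN_I finite_subset subsetD)
  consider "I = {}"
    | (tight) J where "J \<subset> I" "J \<noteq> {}" "card (\<Union>(N ` J)) \<le> card J"
    | (slack) i where "i \<in> I" "\<And>J. J \<subset> I \<Longrightarrow> J \<noteq> {} \<Longrightarrow> card J < card (\<Union>(N ` J))"
    by (metis all_not_in_conv not_le)
  then show ?case
  proof cases
    case 1
    then show ?thesis by simp
  next
    case tight
    let ?U = "\<Union>(N ` J)"
    have finJ: "finite J" using tight fin by (meson finite_subset psubsetE)
    have "\<exists>f. inj_on f J \<and> (\<forall>i\<in>J. f i \<in> N i)"
    proof (rule less.hyps)
      show "card J < card I" using tight(1) fin by (rule psubset_card_mono[rotated])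
    qed (use tight(1) finJ finN hall in auto)
    then obtain f where f: "inj_on f J" "\<And>i. i \<in> J \<Longrightarrow> f i \<in> N i" by blast
    \<comment> \<open>Indices outside \<open>J\<close> must avoid \<open>?U\<close>. Hall's
      condition survives: apply it to \<open>K \<union> J\<close> and subtract
      \<open>card ?U\<close>, which is at most \<open>card J\<close>.\<close>
    have "\<exists>g. inj_on g (I - J) \<and> (\<forall>i\<in>I - J. g i \<in> N i - ?U)"
    proof (rule less.hyps)
      show "card (I - J) < card I"
        using tight fin by (intro psubset_card_mono) auto
      show "finite (I - J)" "\<And>i. i \<in> I - J \<Longrightarrow> finite (N i - ?U)"
        using fin finN by auto
      fix K assume K: "K \<subseteq> I - J"
      then have "finite K" using fin by (meson finite_Diff finite_subset)
      then have "card K + card J = card (K \<union> J)"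
        using K finJ by (subst card_Un_disjoint) auto
      also have "\<dots> \<le> card (\<Union>(N ` (K \<union> J)))"
        using K tight(1) by (intro hall) auto
      also have "\<Union>(N ` (K \<union> J)) = \<Union>((\<lambda>i. N i - ?U) ` K) \<union> ?U" by auto
      also have "card \<dots> \<le> card (\<Union>((\<lambda>i. N i - ?U) ` K)) + card ?U"
        by (rule card_Un_le)
      finally show "card K \<le> card (\<Union>((\<lambda>i. N i - ?U) ` K))"
        using tight(3) by linarith
    qed
    then obtain g where g: "inj_on g (I - J)" "\<And>i. i \<in> I - J \<Longrightarrow> g i \<in> N i - ?U" by blast
    let ?h = "\<lambda>i. if i \<in> J then f i else g i"
    have "inj_on ?h (J \<union> (I - J))"
    proof (subst inj_on_Un, intro conjI)
      show "inj_on ?h J" using f(1) by (simp add: inj_on_def)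
      show "inj_on ?h (I - J)" using g(1) by (simp add: inj_on_def)
      show "?h ` (J - (I - J)) \<inter> ?h ` (I - J - J) = {}" using f(2) g(2) by fastforce
    qed
    then have "inj_on ?h I" using tight(1) by (simp add: Un_absorb1 psubset_imp_subset)
    moreover have "\<forall>i\<in>I. ?h i \<in> N i" using f g by auto
    ultimately show ?thesis by (intro exI[of _ ?h]) blast
  next
    case slack
    have "N i \<noteq> {}" using hall[of "{i}"] slack(1) by auto
    then obtain x where x: "x \<in> N i" by blast
    have "\<exists>f. inj_on f (I - {i}) \<and> (\<forall>j\<in>I - {i}. f j \<in> N j - {x})"
    proof (rule less.hyps)
      show "card (I - {i}) < card I" using slack(1) fin by (rule card_Diff1_less[rotated])
      show "finite (I - {i})" "\<And>j. j \<in> I - {i} \<Longrightarrow> finite (N j - {x})"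
        using fin finN by auto
      fix K assume K: "K \<subseteq> I - {i}"
      show "card K \<le> card (\<Union>((\<lambda>j. N j - {x}) ` K))"
      proof (cases "K = {}")
        \<comment> \<open>Removing \<open>x\<close> costs the union at most one element. As
          \<open>K\<close> omits \<open>i\<close>, it is a proper subset of \<open>I\<close>, and
          the strict inequality pays for this loss.\<close>
        case False
        have "\<Union>((\<lambda>j. N j - {x}) ` K) = \<Union>(N ` K) - {x}" by auto
        then have "card (\<Union>(N ` K)) \<le> card (\<Union>((\<lambda>j. N j - {x}) ` K)) + 1"
          using diff_card_le_card_Diff[of "{x}" "\<Union>(N ` K)"] by simp
        moreover have "card K < card (\<Union>(N ` K))"
          using K slack(1) False by (intro slack(2)) auto
        ultimately show ?thesis by linarith
      qed simp
    qed
    then obtain f where f: "inj_on f (I - {i})" "\<And>j. j \<in> I - {i} \<Longrightarrow> f j \<in> N j - {x}" by blast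
    have "inj_on (f(i := x)) I"
      using f by (auto simp: inj_on_def)
    moreover have "\<forall>j\<in>I. (f(i := x)) j \<in> N j" using f x by auto
    ultimately show ?thesis by blast
  qed
qed

section \<open>Independent sets and clique covers of bipartite graphs\<close>

lemma finite_indep_cards:
  assumes "finite (verts G)"
  shows "finite (card ` {I. I \<subseteq> verts G \<and> indep I (edges G)})"
  using assms by simp

lemma card_indep_le:
  assumes "finite (verts G)" "I \<subseteq> verts G" "indep I (edges G)"
  shows "card I \<le> independence_number G"
  unfolding independence_number_def
  using assms finite_indep_cards by (intro Max_ge) auto

lemma indep_card_exists:
  assumes "finite (verts G)"
  obtains A where "A \<subseteq> verts G" "indep A (edges G)" "card A = independence_number G"
proof -
  have "{} \<in> {I. I \<subseteq> verts G \<and> indep I (edges G)}" by (simp add: indep_def)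
  then have "card ` {I. I \<subseteq> verts G \<and> indep I (edges G)} \<noteq> {}" by blast
  from Max_in[OF finite_indep_cards[OF assms] this] show ?thesis
    using that unfolding independence_number_def by auto
qed

text \<open>
  The map \<open>g\<close> encodes a cover of the vertices by as many cliques as a largest independent set has
  elements: Koenig's theorem without matchings.
\<close>
lemma bipartite_clique_cover:
  assumes G: "simple_graph G" and part: "X \<union> Y = verts G" "X \<inter> Y = {}"
    and bip: "\<And>e. e \<in> edges G \<Longrightarrow> \<exists>x\<in>X. \<exists>y\<in>Y. e = {x, y}"
  obtains A and g :: "'a \<Rightarrow> 'a" where "card A = independence_number G" "finite A" "g ` verts G \<subseteq> A"
    "\<forall>u\<in>verts G. \<forall>v\<in>verts G. g u = g v \<longrightarrow> u \<noteq> v \<longrightarrow> {u, v} \<in> edges G"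
proof -
  have fin: "finite (verts G)" using G by (simp add: simple_graph_def)
  obtain A where A: "A \<subseteq> verts G" "indep A (edges G)" "card A = independence_number G"
    using indep_card_exists[OF fin] .
  have finA: "finite A" using A(1) fin by (rule finite_subset)
  let ?N = "\<lambda>b. {a \<in> A. {b, a} \<in> edges G}"
  have same_side: "{u, v} \<notin> edges G" if "Z = X \<or> Z = Y" "u \<in> Z" "v \<in> Z" for Z u v
    using bip[of "{u, v}"] that part(2) by (auto simp: doubleton_eq_iff)
  \<comment> \<open>Exchange argument: replacing the neighbours of \<open>J\<close> in
    \<open>A\<close> by \<open>J\<close> keeps the set independent, because \<open>J\<close> lies on
    one side. Maximality of \<open>A\<close> then gives Hall's condition for
    \<open>J\<close>.\<close>
  have side: "card J \<le> card (\<Union>(?N ` J))"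
    if Z: "Z = X \<or> Z = Y" and J: "J \<subseteq> (verts G - A) \<inter> Z" for J Z
  proof -
    let ?U = "\<Union>(?N ` J)"
    have finJ: "finite J" using J fin by (meson finite_Diff finite_Int finite_subset)
    have U: "?U \<subseteq> A" by auto
    have "indep (A - ?U \<union> J) (edges G)"
      unfolding indep_def
    proof (intro ballI impI)
      fix u v assume uv: "u \<in> A - ?U \<union> J" "v \<in> A - ?U \<union> J" "u \<noteq> v"
      consider "u \<in> A" "v \<in> A" | "u \<in> J" "v \<in> A - ?U" | "u \<in> A - ?U" "v \<in> J" | "u \<in> J" "v \<in> J"
        using uv by blast
      then show "{u, v} \<notin> edges G"
      proof cases
        case 1
        then show ?thesis using A(2) uv(3) by (simp add: indep_def)
      next
        case 4
        then show ?thesis using same_side[OF Z] J by blast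
      qed (auto simp: insert_commute)
    qed
    then have "card (A - ?U \<union> J) \<le> card A"
      unfolding A(3) using A(1) J fin by (intro card_indep_le) auto
    moreover have "card (A - ?U \<union> J) = card A - card ?U + card J"
      using J finA finJ U finite_subset[OF U finA]
      by (subst card_Un_disjoint) (auto simp: card_Diff_subset)
    moreover have "card ?U \<le> card A" using U finA by (rule card_mono[rotated])
    ultimately show ?thesis by linarith
  qed
  have "\<exists>f. inj_on f (verts G - A) \<and> (\<forall>b\<in>verts G - A. f b \<in> ?N b)"
  proof (rule hall_marriage)
    show "finite (verts G - A)" "\<And>b. finite (?N b)" using fin finA by auto
    fix J assume J: "J \<subseteq> verts G - A"
    have finJ: "finite J" using J fin by (meson finite_Diff finite_subset)
    \<comment> \<open>The two halves of \<open>J\<close> have their neighbours on opposite sides, so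
      the one-sided bounds add up.\<close>
    have "card J = card (J \<inter> X) + card (J \<inter> Y)"
      using J part finJ by (subst card_Un_disjoint[symmetric]) (auto intro: arg_cong[of _ _ card])
    also have "\<dots> \<le> card (\<Union>(?N ` (J \<inter> X))) + card (\<Union>(?N ` (J \<inter> Y)))"
      using J by (intro add_mono side[of X] side[of Y]) auto
    also have "\<dots> = card (\<Union>(?N ` (J \<inter> X)) \<union> \<Union>(?N ` (J \<inter> Y)))"
    proof (rule card_Un_disjoint[symmetric])
      have "a \<in> Y" if "{b, a} \<in> edges G" "b \<in> X" for a b
        using bip[OF that(1)] that(2) part(2) by (auto simp: doubleton_eq_iff)
      moreover have "a \<in> X" if "{b, a} \<in> edges G" "b \<in> Y" for a b
        using bip[OF that(1)] that(2) part(2) by (auto simp: doubleton_eq_iff)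
      ultimately show "\<Union>(?N ` (J \<inter> X)) \<inter> \<Union>(?N ` (J \<inter> Y)) = {}"
        using part(2) by blast
    qed (auto intro: finite_subset[OF _ finA])
    also have "\<dots> \<le> card (\<Union>(?N ` J))"
      by (rule card_mono) (auto intro: finite_subset[OF _ finA])
    finally show "card J \<le> card (\<Union>(?N ` J))" .
  qed
  then obtain f where f: "inj_on f (verts G - A)"
    "\<And>b. b \<in> verts G - A \<Longrightarrow> f b \<in> A \<and> {b, f b} \<in> edges G" by blast
  \<comment> \<open>Each class is named by its member in \<open>A\<close>. Since \<open>f\<close> is
    injective, two distinct vertices with the same value are one vertex of \<open>A\<close> and the
    vertex matched to it.\<close>
  let ?g = "\<lambda>v. if v \<in> A then v else f v"
  show thesis
  proof (rule that[of A ?g])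
    show "\<forall>u\<in>verts G. \<forall>v\<in>verts G. ?g u = ?g v \<longrightarrow> u \<noteq> v \<longrightarrow> {u, v} \<in> edges G"
      using f by (auto simp: inj_on_def insert_commute)
  qed (use A(3) finA f in auto)
qed

section \<open>Growing a connected vertex set\<close>

lemma connected_graph_edge_leaving:
  assumes "simple_graph G" "connected_graph G" "T \<subset> verts G" "T \<noteq> {}"
  obtains w v where "w \<in> T" "v \<in> verts G - T" "{w, v} \<in> edges G"
proof -
  obtain a b where ab: "a \<in> T" "b \<in> verts G" "b \<notin> T" using assms(3,4) by blast
  then have "(a, b) \<in> (adj G)\<^sup>*" using assms(2,3) by (auto simp: connected_graph_def)
  \<comment> \<open>Invariant along a walk from \<open>a\<close>: either its current end is still in
    \<open>T\<close>, or some edge leaves \<open>T\<close>.\<close>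
  then have "b \<in> T \<or> (\<exists>w v. w \<in> T \<and> v \<notin> T \<and> {w, v} \<in> edges G)"
    by (induction rule: rtrancl_induct) (use ab(1) in \<open>auto simp: adj_def\<close>)
  then obtain w v where wv: "w \<in> T" "v \<notin> T" "{w, v} \<in> edges G" using ab(3) by blast
  moreover have "v \<in> verts G" using wv(3) assms(1) by (auto simp: simple_graph_def nsets_def)
  ultimately show thesis using that by blast
qed

text \<open>
  When some class of \<open>g\<close> is split by \<open>T\<close>, the next vertex is taken from that class; otherwise any
  neighbour of \<open>T\<close> will do, and it splits at most its own class.
\<close>
lemma connected_set_splitting_at_most_one_class:
  assumes G: "simple_graph G" "connected_graph G"
    and g: "\<forall>u\<in>verts G. \<forall>v\<in>verts G. g u = g v \<longrightarrow> u \<noteq> v \<longrightarrow> {u, v} \<in> edges G"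
    and "k < card (verts G)"
  shows "\<exists>T S c. T \<subseteq> verts G \<and> card T = Suc k \<and> S \<subseteq> edges G \<and> finite S \<and> card S \<le> k \<and>
    (\<forall>u\<in>T. \<forall>v\<in>T. (u, v) \<in> (adj (spanning_subgraph G S))\<^sup>*) \<and>
    g ` T \<inter> g ` (verts G - T) \<subseteq> {c}"
  using assms(4)
proof (induction k)
  case 0
  then obtain a where "a \<in> verts G" by fastforce
  then show ?case by (intro exI[of _ "{a}"] exI[of _ "{}"] exI[of _ "g a"]) auto
next
  case (Suc k)
  obtain T S c where T: "T \<subseteq> verts G" "card T = Suc k" and S: "S \<subseteq> edges G" "finite S" "card S \<le> k"
    and conn: "\<forall>u\<in>T. \<forall>v\<in>T. (u, v) \<in> (adj (spanning_subgraph G S))\<^sup>*"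
    and c: "g ` T \<inter> g ` (verts G - T) \<subseteq> {c}"
    using Suc.IH[OF Suc_lessD[OF Suc.prems]] by (elim exE conjE) (rule that)
  have finT: "finite T" using T(2) by (metis card.infinite nat.distinct(1))
  obtain w v c' where wv: "w \<in> T" "v \<in> verts G - T" "{w, v} \<in> edges G"
    and c': "g ` insert v T \<inter> g ` (verts G - insert v T) \<subseteq> {c'}"
  proof (cases "g ` T \<inter> g ` (verts G - T) = {}")
    case True
    have "T \<subset> verts G" "T \<noteq> {}" using T Suc.prems by auto
    then obtain w v where "w \<in> T" "v \<in> verts G - T" "{w, v} \<in> edges G"
      using connected_graph_edge_leaving[OF G] by blast
    moreover have "g ` insert v T \<inter> g ` (verts G - insert v T) \<subseteq> {g v}" using True by auto
    ultimately show thesis using that by blast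
  next
    case False
    then obtain w v where "w \<in> T" "v \<in> verts G - T" "g w = g v" by auto
    moreover from this have "{w, v} \<in> edges G" using T(1) by (intro g[rule_format]) auto
    \<comment> \<open>The value \<open>g v = g w\<close> already occurs on \<open>T\<close>, so
      adding \<open>v\<close> cannot split a further class.\<close>
    moreover have "g ` insert v T \<inter> g ` (verts G - insert v T) \<subseteq> {c}"
      using c \<open>w \<in> T\<close> \<open>g w = g v\<close> by (auto 0 4)
    ultimately show thesis using that by blast
  qed
  let ?S = "insert {w, v} S"
  let ?R = "(adj (spanning_subgraph G ?S))\<^sup>*"
  have mono: "(adj (spanning_subgraph G S))\<^sup>* \<subseteq> ?R"
    by (intro rtrancl_mono) (auto simp: adj_def spanning_subgraph_def)
  have step: "(w, v) \<in> ?R" "(v, w) \<in> ?R"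
    by (auto simp: adj_def spanning_subgraph_def insert_commute)
  have "(x, y) \<in> ?R" if "x \<in> insert v T" "y \<in> insert v T" for x y
  proof -
    \<comment> \<open>All connections are routed through \<open>w\<close>, so one new edge per new
      vertex suffices.\<close>
    have "(x, w) \<in> ?R" "(w, y) \<in> ?R" using that conn wv(1) mono step by auto
    then show ?thesis by (rule rtrancl_trans)
  qed
  moreover have "card ?S \<le> Suc k" using S by (simp add: card_insert_if)
  ultimately show ?case
    using T S wv c' finT
    by (intro exI[of _ "insert v T"] exI[of _ ?S] exI[of _ c']) auto
qed

section \<open>Independent sets of a contraction\<close>

lemma set_distance_eq_1:
  assumes "A \<inter> B = {}" "u \<in> A" "v \<in> B" "{u, v} \<in> edges G"
  shows "set_distance G A B = 1"
proof (rule antisym)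
  have "(u, v) \<in> adj G ^^ 1" using assms(4) by (simp add: adj_def)
  then show "set_distance G A B \<le> 1"
    unfolding set_distance_def one_enat_def using assms(2,3) by (intro Inf_lower) blast
  show "1 \<le> set_distance G A B"
    unfolding set_distance_def
  proof (rule Inf_greatest)
    fix x assume "x \<in> {enat n |n u v. u \<in> A \<and> v \<in> B \<and> (u, v) \<in> adj G ^^ n}"
    then obtain n u v where "x = enat n" "u \<in> A" "v \<in> B" "(u, v) \<in> adj G ^^ n" by blast
    moreover from this have "n \<noteq> 0" using assms(1) by (cases n) auto
    ultimately show "1 \<le> x" by (simp add: one_enat_def)
  qed
qed

lemma equiv_connectivity:
  "equiv (verts G) {(u, v). u \<in> verts G \<and> v \<in> verts G \<and> (u, v) \<in> (adj G)\<^sup>*}"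
proof (rule equivI)
  have "sym (adj G)" by (auto simp: sym_def adj_def insert_commute)
  then have "sym ((adj G)\<^sup>*)" by (rule sym_rtrancl)
  then show "sym {(u, v). u \<in> verts G \<and> v \<in> verts G \<and> (u, v) \<in> (adj G)\<^sup>*}"
    by (auto simp: sym_def)
qed (auto simp: refl_on_def trans_def)

text \<open>All of \<open>T\<close> lies in one component \<open>K\<close>. Picking a vertex from
  every other component of an independent set of the quotient gives an independent set outside
  \<open>T\<close>, hence at most \<open>m\<close> vertices; \<open>K\<close> itself accounts for
  the \<open>+ 1\<close>.\<close>

lemma contract_indep_le:
  assumes G: "simple_graph G" and T: "T \<subseteq> verts G" "t \<in> T"
    and conn: "\<And>u v. u \<in> T \<Longrightarrow> v \<in> T \<Longrightarrow> (u, v) \<in> (adj (spanning_subgraph G S))\<^sup>*"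
    and bound: "\<And>I. I \<subseteq> verts G - T \<Longrightarrow> indep I (edges G) \<Longrightarrow> card I \<le> m"
  shows "independence_number (contract G S) \<le> m + 1"
proof -
  let ?C = "components (spanning_subgraph G S)"
  let ?r = "{(u, v). u \<in> verts G \<and> v \<in> verts G \<and> (u, v) \<in> (adj (spanning_subgraph G S))\<^sup>*}"
  have C: "?C = verts G // ?r" by (simp add: components_def spanning_subgraph_def)
  have equiv: "equiv (verts G) ?r"
    using equiv_connectivity[of "spanning_subgraph G S"] by (simp add: spanning_subgraph_def)
  have fin: "finite (verts (contract G S))"
    using simple_graph_contract[OF G] by (simp add: simple_graph_def)
  obtain J where J: "J \<subseteq> verts (contract G S)" "indep J (edges (contract G S))"
    "card J = independence_number (contract G S)"
    using indep_card_exists[OF fin] .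
  have JC: "J \<subseteq> ?C" using J(1) by (simp add: contract_def Let_def)
  have finJ: "finite J" using J(1) fin by (rule finite_subset)
  define K where "K = ?r `` {t}"
  have disj: "P \<inter> Q = {}" if "P \<in> ?C" "Q \<in> ?C" "P \<noteq> Q" for P Q
    using quotient_disj[OF equiv] that unfolding C by blast
  have tV: "t \<in> verts G" using T by blast
  have K: "T \<subseteq> K" "K \<in> ?C"
    using T conn quotientI[OF tV, of ?r] unfolding C by (auto simp: K_def)
  define rep where "rep P = (SOME u. u \<in> P)" for P :: "'a set"
  have rep: "rep P \<in> P" if "P \<in> ?C" for P
    unfolding rep_def using component_nonempty[OF that] by (simp add: some_in_eq)
  let ?I = "rep ` (J - {K})"
  have inj: "inj_on rep (J - {K})"
  proof (rule inj_onI, rule ccontr)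
    fix P Q assume "P \<in> J - {K}" "Q \<in> J - {K}" "rep P = rep Q" "P \<noteq> Q"
    then show False using disj[of P Q] rep[of P] rep[of Q] JC by auto
  qed
  have "card ?I \<le> m"
  proof (rule bound)
    show "?I \<subseteq> verts G - T"
    proof
      fix u assume "u \<in> ?I"
      then obtain P where P: "P \<in> J" "P \<noteq> K" "u = rep P" by blast
      then have "P \<in> ?C" using JC by blast
      then have "u \<in> P" "P \<inter> K = {}" using P rep disj K(2) by auto
      moreover have "P \<subseteq> verts G" using \<open>P \<in> ?C\<close> unfolding C by (auto simp: quotient_def)
      ultimately show "u \<in> verts G - T" using K(1) by blast
    qed
    show "indep ?I (edges G)"
      unfolding indep_def
    proof (intro ballI impI notI)
      fix u v assume "u \<in> ?I" "v \<in> ?I" "u \<noteq> v" and edge: "{u, v} \<in> edges G"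
      then obtain P Q where PQ: "P \<in> J" "Q \<in> J" "u = rep P" "v = rep Q" "P \<noteq> Q" by blast
      then have PQC: "P \<in> ?C" "Q \<in> ?C" using JC by auto
      \<comment> \<open>Distinct components are disjoint, so an edge between representatives makes
        the distance exactly 1, that is, the components adjacent in the quotient.\<close>
      then have "set_distance G P Q = 1"
        using PQ rep disj edge by (intro set_distance_eq_1[of P Q u v]) auto
      then have "{P, Q} \<in> edges (contract G S)"
        using PQC by (auto simp: contract_def Let_def)
      then show False using J(2) PQ by (auto simp: indep_def)
    qed
  qed
  then have "card (J - {K}) \<le> m" using inj by (simp add: card_image)
  then show ?thesis using J(3) diff_card_le_card_Diff[of "{K}" J] by simp
qed

section \<open>Counting the classes inside the contracted set\<close>

theorem theorem5:
  fixes d :: nat and G :: "'a ugraph"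
  assumes "d \<ge> 1"
    and "simple_graph G"
    and "connected_graph G"
    and "bipartite_graph G"
    and "card (verts G) \<ge> 2 * d + 2"
    and "independence_number G \<ge> d + 1"
  shows "\<exists>S \<subseteq> edges G. card S \<le> 2 * d + 1 \<and>
           independence_number (contract G S) \<le> independence_number G - d"
proof -
  obtain X Y where part: "X \<union> Y = verts G" "X \<inter> Y = {}"
    and bip: "\<And>e. e \<in> edges G \<Longrightarrow> \<exists>x\<in>X. \<exists>y\<in>Y. e = {x, y}"
    using assms(4) by (auto simp: bipartite_graph_def)
  obtain A and g :: "'a \<Rightarrow> 'a" where A: "card A = independence_number G" "finite A" "g ` verts G \<subseteq> A"
    and g: "\<forall>u\<in>verts G. \<forall>v\<in>verts G. g u = g v \<longrightarrow> u \<noteq> v \<longrightarrow> {u, v} \<in> edges G"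
    by (rule bipartite_clique_cover[OF assms(2) part bip])
  have fin: "finite (verts G)" using assms(2) by (simp add: simple_graph_def)
  \<comment> \<open>Classes are cliques and each side is independent, so a class has at most one
    vertex on each side and at most two in all.\<close>
  have g_inj: "inj_on g Z" if "Z = X \<or> Z = Y" for Z
  proof (rule inj_onI, rule ccontr)
    fix u v assume uv: "u \<in> Z" "v \<in> Z" "g u = g v" "u \<noteq> v"
    then have "{u, v} \<in> edges G" using that part(1) by (intro g[rule_format]) auto
    then show False using bip[of "{u, v}"] uv that part(2) by (auto simp: doubleton_eq_iff)
  qed
  have half: "card U \<le> 2 * card (g ` U)" if U: "U \<subseteq> verts G" for U
  proof -
    have finU: "finite U" using U fin by (rule finite_subset)
    have "card (U \<inter> Z) \<le> card (g ` U)" if "Z = X \<or> Z = Y" for Z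
    proof -
      have "card (U \<inter> Z) = card (g ` (U \<inter> Z))"
        using inj_on_subset[OF g_inj[OF that]] by (intro card_image[symmetric]) auto
      also have "\<dots> \<le> card (g ` U)" using finU by (intro card_mono) auto
      finally show ?thesis .
    qed
    from this[of X] this[of Y] have "card (U \<inter> X) + card (U \<inter> Y) \<le> 2 * card (g ` U)" by simp
    moreover have "card (U \<inter> X) + card (U \<inter> Y) = card U"
      using U part finU by (subst card_Un_disjoint[symmetric]) (auto intro: arg_cong[of _ _ card])
    ultimately show ?thesis by simp
  qed
  have "2 * d + 1 < card (verts G)" using assms(5) by simp
  obtain T S c where T: "T \<subseteq> verts G" "card T = Suc (2 * d + 1)"
    and S: "S \<subseteq> edges G" "card S \<le> 2 * d + 1"
    and conn: "\<forall>u\<in>T. \<forall>v\<in>T. (u, v) \<in> (adj (spanning_subgraph G S))\<^sup>*"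
    and c: "g ` T \<inter> g ` (verts G - T) \<subseteq> {c}"
    using connected_set_splitting_at_most_one_class[OF assms(2,3) g \<open>2 * d + 1 < card (verts G)\<close>]
    by (elim exE conjE) (rule that)
  have finT: "finite T" using T(1) fin by (rule finite_subset)
  obtain t where t: "t \<in> T" using T(2) by fastforce
  \<comment> \<open>\<open>W\<close> names the classes that lie wholly inside
    \<open>T\<close>.\<close>
  define W where "W = g ` T - g ` (verts G - T)"
  have "d + 1 \<le> card W"
  proof (cases "g ` T \<inter> g ` (verts G - T) = {}")
    case True
    then have "W = g ` T" by (auto simp: W_def)
    then show ?thesis using half[OF T(1)] T(2) by simp
  next
    case False
    then have "c \<in> g ` (verts G - T)" using c by blast
    then obtain v where v: "v \<in> verts G - T" "g v = c" by blast
    let ?F = "{u \<in> T. g u = c}"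
    \<comment> \<open>The split class has at most two vertices and one of them, \<open>v\<close>, is
      outside \<open>T\<close>. So at most one vertex of \<open>T\<close> is lost, and the remaining
      \<open>2 * d + 1\<close> still need \<open>d + 1\<close> classes, by parity.\<close>
    have "card (insert v ?F) \<le> 2 * card (g ` insert v ?F)"
      using T(1) v by (intro half) auto
    also have "g ` insert v ?F = {c}" using v(2) by auto
    finally have "card ?F \<le> 1" using v finT by simp
    then have "2 * d + 1 \<le> card (T - ?F)"
      using diff_card_le_card_Diff[of ?F T] finT T(2) by simp
    also have "\<dots> \<le> 2 * card (g ` (T - ?F))" using T(1) by (intro half) auto
    also have "g ` (T - ?F) \<subseteq> W" using c by (auto simp: W_def)
    then have "card (g ` (T - ?F)) \<le> card W"
      using finT by (intro card_mono) (auto simp: W_def)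
    finally show ?thesis by simp
  qed
  have "independence_number (contract G S) \<le> (independence_number G - (d + 1)) + 1"
  proof (rule contract_indep_le[OF assms(2) T(1) t conn[rule_format]])
    fix I assume I: "I \<subseteq> verts G - T" "indep I (edges G)"
    \<comment> \<open>An independent set takes at most one vertex from each class, and outside
      \<open>T\<close> it meets no class named in \<open>W\<close>.\<close>
    have "inj_on g I"
      using I g unfolding inj_on_def indep_def by blast
    then have "card I = card (g ` I)" by (simp add: card_image)
    also have "\<dots> \<le> card (A - W)"
      using I(1) A(2,3) by (intro card_mono) (auto simp: W_def)
    also have "\<dots> = independence_number G - card W"
      using A T(1) finT by (subst card_Diff_subset) (auto simp: W_def)
    finally show "card I \<le> independence_number G - (d + 1)"
      using \<open>d + 1 \<le> card W\<close> by linarith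
  qed
  \<comment> \<open>As \<alpha>(G) is at least \<open>d + 1\<close>, the subtraction is not
    truncated and the bound equals \<alpha>(G) - d.\<close>
  then show ?thesis using S assms(6) by (intro exI[of _ S]) auto
qed

end
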